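(* Let $X$ be a topological space, $A\subset X$ be a compact set, and let the functions $f$ and $\varphi$ be lower semicontinuous on $A$. Then the penalty function $F_\lambda=f+\lambda\varphi$ is (globally) exact if and only if it is exact at every globally optimal solution of the problem $(\mathcal{P})$: $\min f(x)$ subject to $x\in M$, $x\in A$.
   Context: $M,A\subset X$ are nonempty, $f\colon X\to\mathbb{R}\cup\{+\infty\}$, $\varphi\colon X\to[0,+\infty)$ with $M=\{x\in X\mid\varphi(x)=0\}$, $\Omega=M\cap A$, $F_\lambda(x)=f(x)+\lambda\varphi(x)$ for $\lambda\ge0$. Standing assumptions: $f(x)<+\infty$ for some $x\in\Omega$, and $f$ attains a global minimum on $\Omega$, i.e. $(\mathcal{P})$ has a globally optimal solution. The penalty function $F_\lambda$ is (globally) exact if there exists $\lambda_0\ge0$ such that for every $\lambda>\lambda_0$ the set of global minimizers of $F_\lambda$ on $A$ coincides with the set of globally optimal solutions of $(\mathcal{P})$. It is exact at a point $x^*$ (a locally, in particular globally, optimal solution of $(\mathcal{P})$) if there exists $\lambda^*\ge0$ such that $x^*$ is a point of local minimum of $F_{\lambda^*}$ on $A$. *)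

theory Defs
  imports "HOL-Analysis.Analysis"
begin

text \<open>
  Lower semicontinuity of the restriction of \<open>f\<close> to \<open>A\<close> with the subspace topology: only
  points of \<open>A\<close> near \<open>x\<close> are tested. With \<open>A = UNIV\<close> this is ordinary lower
  semicontinuity. The filter excludes \<open>x\<close>, where the inequality is the hypothesis
  \<open>c < f x\<close> itself.
\<close>

definition lsc_on :: "'a::topological_space set \<Rightarrow> ('a \<Rightarrow> 'b::linorder) \<Rightarrow> bool" where
  "lsc_on A f \<longleftrightarrow> (\<forall>x\<in>A. \<forall>c. c < f x \<longrightarrow> (\<forall>\<^sub>F y in at x within A. c < f y))"

definition global_minimizers :: "'a set \<Rightarrow> ('a \<Rightarrow> 'b::linorder) \<Rightarrow> 'a set" where
  "global_minimizers S g = {x. is_arg_min g (\<lambda>y. y \<in> S) x}"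

definition local_minimizer ::
    "'a::topological_space set \<Rightarrow> ('a \<Rightarrow> 'b::linorder) \<Rightarrow> 'a \<Rightarrow> bool" where
  "local_minimizer S g x \<longleftrightarrow>
     x \<in> S \<and> (\<exists>U. open U \<and> x \<in> U \<and> (\<forall>y \<in> U \<inter> S. g x \<le> g y))"

definition penalty_fun :: "('a \<Rightarrow> ereal) \<Rightarrow> ('a \<Rightarrow> real) \<Rightarrow> real \<Rightarrow> 'a \<Rightarrow> ereal" where
  "penalty_fun f \<phi> l x = f x + ereal (l * \<phi> x)"

definition globally_optimal :: "'a set \<Rightarrow> 'a set \<Rightarrow> ('a \<Rightarrow> ereal) \<Rightarrow> 'a set" where
  "globally_optimal M A f = global_minimizers (M \<inter> A) f"

definition globally_exact ::
    "'a set \<Rightarrow> 'a set \<Rightarrow> ('a \<Rightarrow> ereal) \<Rightarrow> ('a \<Rightarrow> real) \<Rightarrow> bool" where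
  "globally_exact M A f \<phi> \<longleftrightarrow>
     (\<exists>l0\<ge>0. \<forall>l>l0. global_minimizers A (penalty_fun f \<phi> l) = globally_optimal M A f)"

text \<open>
  Exactness at a point is meant for locally optimal solutions \<open>x\<close> of the problem of minimizing
  \<open>f\<close> over \<open>M \<inter> A\<close>; this is left to the place of use, as every globally optimal
  solution is one.
\<close>

definition exact_at ::
    "'a::topological_space set \<Rightarrow> ('a \<Rightarrow> ereal) \<Rightarrow> ('a \<Rightarrow> real) \<Rightarrow> 'a \<Rightarrow> bool" where
  "exact_at A f \<phi> x \<longleftrightarrow> (\<exists>l\<ge>0. local_minimizer A (penalty_fun f \<phi> l) x)"

end

theory Submission
  imports Defs
begin

text \<open>
  Let \<open>v\<close> be the optimal value, and let \<open>F\<^sub>\<lambda> = f + \<lambda>\<phi>\<close>. Every point of \<open>A\<close> has a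
  neighbourhood on which \<open>F\<^sub>\<lambda> \<ge> v\<close> for all large \<open>\<lambda>\<close>: at infeasible points because \<open>f\<close> is
  bounded below and \<open>\<phi>\<close> is bounded away from zero nearby, at feasible nonoptimal points because
  \<open>f > v\<close> nearby, and at optimal points by exactness. By compactness a single \<open>\<lambda>\<close> works on
  all of \<open>A\<close>, and any larger penalty parameter makes the inequality strict at infeasible points.
\<close>

text \<open>Each point brings its own threshold \<open>l x\<close>, valid on a whole neighbourhood
  \<open>U x\<close>. A finite subcover leaves only finitely many thresholds, and by monotonicity
  their maximum serves for all of \<open>A\<close>.\<close>

lemma compact_uniform_threshold:
  fixes A :: "'a::topological_space set" and P :: "real \<Rightarrow> 'a \<Rightarrow> bool"
  assumes "compact A"
    and mono: "\<And>k l x. P k x \<Longrightarrow> k \<le> l \<Longrightarrow> P l x"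
    and loc: "\<And>x. x \<in> A \<Longrightarrow> \<exists>U l. open U \<and> x \<in> U \<and> (\<forall>y\<in>U \<inter> A. P l y)"
  shows "\<exists>l\<ge>0. \<forall>x\<in>A. P l x"
proof -
  obtain U l where U: "\<And>x. x \<in> A \<Longrightarrow> open (U x) \<and> x \<in> U x \<and> (\<forall>y\<in>U x \<inter> A. P (l x) y)"
    using loc by metis
  obtain C where C: "C \<subseteq> A" "finite C" "A \<subseteq> (\<Union>x\<in>C. U x)"
  proof (rule compactE_image[OF \<open>compact A\<close>, of A U])
    show "A \<subseteq> (\<Union>x\<in>A. U x)" using U by blast
  qed (use U in auto)
  let ?L = "Max (insert 0 (l ` C))"
  have "P ?L y" if y: "y \<in> A" for y
  proof -
    obtain x where x: "x \<in> C" "y \<in> U x" using C(3) y by auto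
    then have "P (l x) y" using U C(1) y by auto
    moreover have "l x \<le> ?L" using x C(2) by simp
    ultimately show ?thesis by (rule mono)
  qed
  moreover have "0 \<le> ?L" using C(2) by simp
  ultimately show ?thesis by blast
qed

lemma lsc_onE:
  assumes "lsc_on A f" "x \<in> A" "c < f x"
  obtains U where "open U" "x \<in> U" "\<And>y. y \<in> U \<inter> A \<Longrightarrow> c < f y"
proof -
  from assms have "\<forall>\<^sub>F y in at x within A. c < f y"
    unfolding lsc_on_def by blast
  then obtain U where U: "open U" "x \<in> U" "\<forall>y\<in>U. y \<noteq> x \<longrightarrow> y \<in> A \<longrightarrow> c < f y"
    unfolding eventually_at_topological by blast
  show thesis using U assms(3) by (intro that[of U]) auto
qed

lemma penalty_fun_mono:
  "0 \<le> \<phi> x \<Longrightarrow> k \<le> l \<Longrightarrow> penalty_fun f \<phi> k x \<le> penalty_fun f \<phi> l x"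
  unfolding penalty_fun_def by (intro add_mono) (auto intro: mult_right_mono)

lemma penalty_fun_feasible: "\<phi> x = 0 \<Longrightarrow> penalty_fun f \<phi> l x = f x"
  by (simp add: penalty_fun_def zero_ereal_def[symmetric])

lemma mem_global_minimizers_iff:
  "x \<in> global_minimizers S g \<longleftrightarrow> x \<in> S \<and> (\<forall>y\<in>S. g x \<le> g y)"
  by (auto simp: global_minimizers_def is_arg_min_linorder)

text \<open>Near \<open>x\<close>, lower semicontinuity keeps \<open>f\<close> above a real
  \<open>m\<close> and \<phi> above a positive \<open>c\<close>. The deficit \<open>v - m\<close> is
  then bounded, and a large multiple of \<open>c\<close> makes up for it.\<close>

lemma locally_large_penalty:
  fixes f :: "'a::topological_space \<Rightarrow> ereal" and v :: real
  assumes "lsc_on A f" "lsc_on A \<phi>" "x \<in> A" "f x \<noteq> -\<infinity>" "0 < \<phi> x"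
  shows "\<exists>U l. open U \<and> x \<in> U \<and> (\<forall>y\<in>U \<inter> A. ereal v \<le> penalty_fun f \<phi> l y)"
proof -
  \<comment> \<open>Such a real exists even when \<open>f x\<close> is infinite, since only the
    value \<open>-\<infinity>\<close> is excluded.\<close>
  obtain m :: real where m: "ereal m < f x"
    using ereal_dense2[of "-\<infinity>" "f x"] assms(4) by auto
  define c where "c = \<phi> x / 2"
  have c: "0 < c" "c < \<phi> x" using assms(5) by (auto simp: c_def)
  obtain U where U: "open U" "x \<in> U" "\<And>y. y \<in> U \<inter> A \<Longrightarrow> ereal m < f y"
    using lsc_onE[OF assms(1,3) m] by blast
  obtain V where V: "open V" "x \<in> V" "\<And>y. y \<in> V \<inter> A \<Longrightarrow> c < \<phi> y"
    using lsc_onE[OF assms(2,3) c(2)] by blast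
  \<comment> \<open>Chosen so that \<open>m + l * c\<close> reaches \<open>v\<close>; the lower
    bound 0 lets \<open>c < \<phi> y\<close> be multiplied by \<open>l\<close>.\<close>
  define l where "l = max 0 ((v - m) / c)"
  have "ereal v \<le> penalty_fun f \<phi> l y" if "y \<in> (U \<inter> V) \<inter> A" for y
  proof -
    have "v - m \<le> l * c" using c(1) by (simp add: l_def pos_divide_le_eq[symmetric])
    also have "\<dots> \<le> l * \<phi> y"
      using V(3)[of y] that by (intro mult_left_mono) (auto simp: l_def)
    finally have "ereal v \<le> ereal m + ereal (l * \<phi> y)" by simp
    also have "\<dots> \<le> f y + ereal (l * \<phi> y)"
      using U(3)[of y] that by (intro add_right_mono) auto
    finally show ?thesis by (simp add: penalty_fun_def)
  qed
  with U V show ?thesis by (intro exI[of _ "U \<inter> V"] exI[of _ l]) auto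
qed

text \<open>With parameter \<open>k\<close> the minimum over \<open>A\<close> is already
  \<open>f z\<close>, attained at \<open>z\<close>, but possibly at infeasible points too. Passing
  to \<open>l > k\<close> strictly raises every finite value at an infeasible point and leaves
  feasible points unchanged, so only optimal solutions remain.\<close>

lemma global_minimizers_penalty_fun_eq:
  fixes f :: "'a \<Rightarrow> ereal"
  assumes nonneg: "\<And>x. 0 \<le> \<phi> x" and z: "z \<in> globally_optimal {x. \<phi> x = 0} A f"
    and fin: "\<bar>f z\<bar> \<noteq> \<infinity>"
    and bound: "\<And>x. x \<in> A \<Longrightarrow> f z \<le> penalty_fun f \<phi> k x" and "k < l"
  shows "global_minimizers A (penalty_fun f \<phi> l) = globally_optimal {x. \<phi> x = 0} A f"
proof (intro set_eqI iffI)
  have zA: "z \<in> A" "\<phi> z = 0" and zmin: "\<And>y. \<phi> y = 0 \<Longrightarrow> y \<in> A \<Longrightarrow> f z \<le> f y"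
    using z by (auto simp: globally_optimal_def mem_global_minimizers_iff)
  fix x
  { assume "x \<in> global_minimizers A (penalty_fun f \<phi> l)"
    then have xA: "x \<in> A" and "penalty_fun f \<phi> l x \<le> penalty_fun f \<phi> l z"
      using zA by (auto simp: mem_global_minimizers_iff)
    then have le: "penalty_fun f \<phi> l x \<le> f z" by (simp add: penalty_fun_feasible zA(2))
    have "\<phi> x = 0"
    proof (rule ccontr)
      assume "\<phi> x \<noteq> 0"
      with nonneg[of x] have "k * \<phi> x < l * \<phi> x" using \<open>k < l\<close> by simp
      moreover have "f x + ereal (l * \<phi> x) \<le> f x + ereal (k * \<phi> x)"
        using order_trans[OF le bound[OF xA]] by (simp add: penalty_fun_def)
      \<comment> \<open>Finiteness allows \<open>f x\<close> to be cancelled: the bound for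
        \<open>k\<close> rules out \<open>-\<infinity>\<close>, and minimality for \<open>l\<close>
        rules out \<open>\<infinity>\<close>.\<close>
      moreover have "\<bar>f x\<bar> \<noteq> \<infinity>"
        using le bound[OF xA] fin by (cases "f x"; cases "f z") (auto simp: penalty_fun_def)
      ultimately show False by (cases "f x") auto
    qed
    with le have "f x \<le> f z" by (simp add: penalty_fun_feasible)
    with xA \<open>\<phi> x = 0\<close> zmin show "x \<in> globally_optimal {x. \<phi> x = 0} A f"
      by (auto simp: globally_optimal_def mem_global_minimizers_iff intro: order_trans) }
  { assume "x \<in> globally_optimal {x. \<phi> x = 0} A f"
    then have x: "x \<in> A" "\<phi> x = 0" "f x \<le> f z"
      using zA by (auto simp: globally_optimal_def mem_global_minimizers_iff)
    have "f x \<le> penalty_fun f \<phi> l y" if "y \<in> A" for y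
      using x(3) bound[OF that] penalty_fun_mono[of \<phi> y k l f] nonneg[of y] \<open>k < l\<close>
      by (meson less_imp_le order_trans)
    with x show "x \<in> global_minimizers A (penalty_fun f \<phi> l)"
      by (auto simp: mem_global_minimizers_iff penalty_fun_feasible) }
qed

theorem theorem3p7:
  fixes M A :: "'a::topological_space set"
    and f :: "'a \<Rightarrow> ereal"
    and \<phi> :: "'a \<Rightarrow> real"
  assumes "M \<noteq> {}" and "A \<noteq> {}"
    and "\<And>x. f x \<noteq> -\<infinity>"
    and "\<And>x. 0 \<le> \<phi> x"
    and "M = {x. \<phi> x = 0}"
    and "\<exists>x \<in> M \<inter> A. f x < \<infinity>"
    and "globally_optimal M A f \<noteq> {}"
    and "compact A"
    and "lsc_on A f" and "lsc_on A \<phi>"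
  shows "globally_exact M A f \<phi> \<longleftrightarrow> (\<forall>x \<in> globally_optimal M A f. exact_at A f \<phi> x)"
proof
  assume "globally_exact M A f \<phi>"
  then obtain l0 where "l0 \<ge> 0"
    and l0: "\<And>l. l > l0 \<Longrightarrow> global_minimizers A (penalty_fun f \<phi> l) = globally_optimal M A f"
    by (auto simp: globally_exact_def)
  show "\<forall>x \<in> globally_optimal M A f. exact_at A f \<phi> x"
  proof
    fix x assume "x \<in> globally_optimal M A f"
    with l0[of "l0 + 1"] have "x \<in> global_minimizers A (penalty_fun f \<phi> (l0 + 1))" by simp
    \<comment> \<open>The whole space serves as the neighbourhood.\<close>
    then have "local_minimizer A (penalty_fun f \<phi> (l0 + 1)) x"
      by (auto simp: local_minimizer_def mem_global_minimizers_iff)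
    with \<open>l0 \<ge> 0\<close> show "exact_at A f \<phi> x"
      unfolding exact_at_def by (intro exI[of _ "l0 + 1"]) simp
  qed
next
  assume exact: "\<forall>x \<in> globally_optimal M A f. exact_at A f \<phi> x"
  obtain z where z: "z \<in> globally_optimal M A f" using assms(7) by blast
  then have zmin: "\<And>y. y \<in> M \<inter> A \<Longrightarrow> f z \<le> f y"
    by (auto simp: globally_optimal_def mem_global_minimizers_iff)
  with assms(6) have "f z < \<infinity>" by (meson le_less_trans)
  with assms(3)[of z] obtain v where v: "f z = ereal v" by (cases "f z") auto
  have local_bound: "\<exists>U l. open U \<and> x \<in> U \<and> (\<forall>y\<in>U \<inter> A. ereal v \<le> penalty_fun f \<phi> l y)"
    if x: "x \<in> A" for x
  proof (cases "\<phi> x = 0")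
    case False
    with assms(4)[of x] have "0 < \<phi> x" by simp
    then show ?thesis by (rule locally_large_penalty[OF assms(9,10) x assms(3)])
  next
    case feasible: True
    with x assms(5) have xM: "x \<in> M \<inter> A" by simp
    show ?thesis
    proof (cases "ereal v < f x")
      case True
      then obtain U where U: "open U" "x \<in> U" "\<And>y. y \<in> U \<inter> A \<Longrightarrow> ereal v < f y"
        using lsc_onE[OF assms(9) x] by blast
      \<comment> \<open>Here \<open>f\<close> alone exceeds \<open>v\<close> on \<open>U\<close>, so
        the penalty parameter can be 0.\<close>
      then show ?thesis
        by (intro exI[of _ U] exI[of _ 0])
          (auto simp: penalty_fun_def zero_ereal_def[symmetric] intro: less_imp_le)
    next
      case False
      with zmin[OF xM] v have fx: "f x = ereal v" by simp
      then have "x \<in> globally_optimal M A f"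
        using xM zmin v by (auto simp: globally_optimal_def mem_global_minimizers_iff)
      with exact obtain l where "local_minimizer A (penalty_fun f \<phi> l) x"
        by (auto simp: exact_at_def)
      \<comment> \<open>The penalty vanishes at \<open>x\<close>, so the local minimum value is
        exactly \<open>v\<close>, and local minimality is the required bound.\<close>
      then show ?thesis
        using penalty_fun_feasible[of \<phi> x f l, OF feasible] fx
        by (auto simp: local_minimizer_def)
    qed
  qed
  have "\<exists>k\<ge>0. \<forall>x\<in>A. ereal v \<le> penalty_fun f \<phi> k x"
  proof (rule compact_uniform_threshold[OF assms(8) _ local_bound])
    fix k l :: real and x
    assume "ereal v \<le> penalty_fun f \<phi> k x" "k \<le> l"
    with penalty_fun_mono[of \<phi> x k l f] assms(4)[of x]
    show "ereal v \<le> penalty_fun f \<phi> l x" by (auto intro: order_trans)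
  qed
  then obtain k where "k \<ge> 0" and k: "\<And>x. x \<in> A \<Longrightarrow> f z \<le> penalty_fun f \<phi> k x"
    using v by auto
  show "globally_exact M A f \<phi>"
    unfolding globally_exact_def
  \<comment> \<open>The uniform threshold \<open>k\<close> itself is the exactness parameter,
    because only \<open>l > k\<close> is considered.\<close>
  proof (intro exI[of _ k] conjI allI impI)
    fix l assume "k < l"
    show "global_minimizers A (penalty_fun f \<phi> l) = globally_optimal M A f"
      unfolding assms(5)
    proof (rule global_minimizers_penalty_fun_eq[where z = z and k = k])
      show "z \<in> globally_optimal {x. \<phi> x = 0} A f" using z assms(5) by simp
    qed (use assms(4) k v \<open>k < l\<close> in auto)
  qed fact
qed

end
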